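(* Let $\mathbb{H}$ be a complex Hilbert space and let $S\in\mathbb{B}(\mathbb{H})$ be an accretive operator. Then $$\frac{\sqrt3}{3}\|S\|\le\omega(S).$$ The same inequality also holds when $S\in\mathbb{B}(\mathbb{H})$ is a dissipative operator.
   Context: $\mathbb{B}(\mathbb{H})$ is the $C^*$-algebra of bounded linear operators on the Hilbert space $\mathbb{H}$, with operator norm $\|\cdot\|$; $\omega(S)=\sup_{\|x\|=1}|\langle Sx,x\rangle|$ is the numerical radius. An operator $X$ is positive if $\langle Xx,x\rangle\ge 0$ for all $x\in\mathbb{H}$. Write $\Re S=\frac{S+S^*}{2}$ and $\Im S=\frac{S-S^*}{2i}$. $S$ is accretive if $\Re S$ is positive, and dissipative if $\Im S$ is positive. *)

theory Defs
  imports "HOL-Analysis.Analysis"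
begin

class complex_vector = real_vector +
  fixes scaleC :: "complex \<Rightarrow> 'a \<Rightarrow> 'a" (infixr \<open>*\<^sub>C\<close> 75)
  assumes scaleC_add_right: "a *\<^sub>C (x + y) = a *\<^sub>C x + a *\<^sub>C y"
    and scaleC_add_left: "(a + b) *\<^sub>C x = a *\<^sub>C x + b *\<^sub>C x"
    and scaleC_scaleC: "a *\<^sub>C (b *\<^sub>C x) = (a * b) *\<^sub>C x"
    and scaleC_of_real: "complex_of_real r *\<^sub>C x = r *\<^sub>R x"

text \<open>The inner product is linear in its first argument. Since the norm of a normed space is
  definite, the last axiom includes positive definiteness of the inner product.\<close>

class complex_inner = complex_vector + real_normed_vector +
  fixes cinner :: "'a \<Rightarrow> 'a \<Rightarrow> complex"
  assumes cinner_commute: "cinner x y = cnj (cinner y x)"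
    and cinner_add_left: "cinner (x + y) z = cinner x z + cinner y z"
    and cinner_scaleC_left: "cinner (a *\<^sub>C x) y = a * cinner x y"
    and cinner_self_norm: "cinner x x = complex_of_real ((norm x)\<^sup>2)"

class chilbert_space = complex_inner + banach

instantiation complex :: chilbert_space
begin

definition scaleC_complex :: "complex \<Rightarrow> complex \<Rightarrow> complex" where
  "scaleC_complex a x = a * x"

definition cinner_complex :: "complex \<Rightarrow> complex \<Rightarrow> complex" where
  "cinner_complex x y = x * cnj y"

instance
proof
  fix x :: complex
  show "cinner x x = complex_of_real ((norm x)\<^sup>2)"
    unfolding cinner_complex_def by (rule complex_norm_square [symmetric])
qed (simp_all add: scaleC_complex_def cinner_complex_def algebra_simps scaleR_conv_of_real)

end

text \<open>The elements of \<open>\<bbbB>(\<bbbH>)\<close> are the functions satisfying this predicate;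
  their operator norm is the library's \<^const>\<open>onorm\<close>.\<close>

locale bounded_clinear = bounded_linear f
  for f :: "'a::complex_inner \<Rightarrow> 'b::complex_inner" +
  assumes scaleC: "f (a *\<^sub>C x) = a *\<^sub>C f x"

text \<open>Well defined for bounded operators on a Hilbert space, by the Riesz representation
  theorem.\<close>

definition cadjoint :: "('a::chilbert_space \<Rightarrow> 'a) \<Rightarrow> 'a \<Rightarrow> 'a" where
  "cadjoint S = (THE T. \<forall>x y. cinner (S x) y = cinner x (T y))"

definition op_Re :: "('a::chilbert_space \<Rightarrow> 'a) \<Rightarrow> 'a \<Rightarrow> 'a" where
  "op_Re S = (\<lambda>x. (1 / 2) *\<^sub>C (S x + cadjoint S x))"

definition op_Im :: "('a::chilbert_space \<Rightarrow> 'a) \<Rightarrow> 'a \<Rightarrow> 'a" where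
  "op_Im S = (\<lambda>x. (1 / (2 * \<i>)) *\<^sub>C (S x - cadjoint S x))"

definition positive_op :: "('a::chilbert_space \<Rightarrow> 'a) \<Rightarrow> bool" where
  "positive_op X \<longleftrightarrow> (\<forall>x. cinner (X x) x \<in> \<real>\<^sub>\<ge>\<^sub>0)"

definition accretive :: "('a::chilbert_space \<Rightarrow> 'a) \<Rightarrow> bool" where
  "accretive S \<longleftrightarrow> positive_op (op_Re S)"

definition dissipative :: "('a::chilbert_space \<Rightarrow> 'a) \<Rightarrow> bool" where
  "dissipative S \<longleftrightarrow> positive_op (op_Im S)"

text \<open>All values are nonnegative, so inserting \<open>0\<close> only matters on the zero space, where there
  are no unit vectors: it gives the convention that the supremum is then \<open>0\<close>.\<close>

definition numerical_radius :: "('a::chilbert_space \<Rightarrow> 'a) \<Rightarrow> real" where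
  "numerical_radius S = Sup (insert 0 {cmod (cinner (S x) x) | x. norm x = 1})"

end

theory Submission
  imports Defs
begin

text \<open>Write \<open>S = A + iB\<close> with \<open>A\<close>, \<open>B\<close> self-adjoint and let \<open>w\<close> be the numerical radius.
  Then \<open>\<parallel>Sx\<parallel>\<^sup>2 = \<parallel>Ax\<parallel>\<^sup>2 + \<parallel>Bx\<parallel>\<^sup>2 + 2 Im \<langle>Ax, Bx\<rangle>\<close>, and \<open>A\<close>, \<open>B\<close> have norm at most \<open>w\<close>.
  As \<open>\<langle>x, Bx\<rangle>\<close> is real, \<open>A\<close> may be replaced by \<open>A - w/2\<close> in the last term; if \<open>0 \<le> A \<le> w\<close>, this
  operator has norm at most \<open>w/2\<close>, so \<open>\<parallel>Sx\<parallel>\<^sup>2 \<le> 3 w\<^sup>2 \<parallel>x\<parallel>\<^sup>2\<close>. If \<open>B\<close> is positive instead, exchange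
  the roles of \<open>A\<close> and \<open>B\<close>.\<close>

section \<open>Inner product algebra and the Cauchy--Schwarz inequality\<close>

lemma cinner_add_right: "cinner x (y + z) = cinner x y + cinner (x::'a::complex_inner) z"
  by (metis cinner_add_left cinner_commute complex_cnj_add)

lemma cinner_scaleC_right: "cinner x (a *\<^sub>C y) = cnj a * cinner (x::'a::complex_inner) y"
  by (metis cinner_commute cinner_scaleC_left complex_cnj_mult)

lemma cinner_scaleR_left: "cinner (r *\<^sub>R x) y = of_real r * cinner (x::'a::complex_inner) y"
  by (metis cinner_scaleC_left scaleC_of_real)

lemma cinner_scaleR_right: "cinner x (r *\<^sub>R y) = of_real r * cinner (x::'a::complex_inner) y"
  by (metis cinner_scaleC_right scaleC_of_real complex_cnj_complex_of_real)

lemma cinner_minus_left: "cinner (- x) y = - cinner (x::'a::complex_inner) y"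
  using cinner_scaleR_left[of "-1" x y] by simp

lemma cinner_minus_right: "cinner x (- y) = - cinner (x::'a::complex_inner) y"
  using cinner_scaleR_right[of x "-1" y] by simp

lemma cinner_diff_left: "cinner (x - y) z = cinner x z - cinner (y::'a::complex_inner) z"
  using cinner_add_left[of x "- y" z] by (simp add: cinner_minus_left)

lemma cinner_diff_right: "cinner x (y - z) = cinner x y - cinner (x::'a::complex_inner) z"
  using cinner_add_right[of x y "- z"] by (simp add: cinner_minus_right)

lemmas cinner_simps = cinner_add_left cinner_add_right cinner_diff_left cinner_diff_right
  cinner_minus_left cinner_minus_right cinner_scaleC_left cinner_scaleC_right
  cinner_scaleR_left cinner_scaleR_right

lemma Re_cinner_commute: "Re (cinner x y) = Re (cinner (y::'a::complex_inner) x)"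
  by (metis cinner_commute cnj.simps(1))

lemma Im_cinner_commute: "Im (cinner x y) = - Im (cinner (y::'a::complex_inner) x)"
  by (metis cinner_commute cnj.simps(2))

lemma Re_cinner_self: "Re (cinner x x) = (norm (x::'a::complex_inner))\<^sup>2"
  by (simp add: cinner_self_norm)

lemma norm_add_sq:
  "(norm (x + y))\<^sup>2 = (norm x)\<^sup>2 + (norm y)\<^sup>2 + 2 * Re (cinner (x::'a::complex_inner) y)"
  unfolding Re_cinner_self[symmetric]
  by (simp add: cinner_simps Re_cinner_commute[of y x])

lemma norm_diff_sq:
  "(norm (x - y))\<^sup>2 = (norm x)\<^sup>2 + (norm y)\<^sup>2 - 2 * Re (cinner (x::'a::complex_inner) y)"
  unfolding Re_cinner_self[symmetric]
  by (simp add: cinner_simps Re_cinner_commute[of y x])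

text \<open>The class axioms state homogeneity of the norm for real scalars; the complex case is
  read off from the inner product of the vector with itself.\<close>

lemma norm_scaleC: "norm (a *\<^sub>C x) = cmod a * norm (x::'a::complex_inner)"
proof -
  have "complex_of_real ((norm (a *\<^sub>C x))\<^sup>2) = a * cnj a * complex_of_real ((norm x)\<^sup>2)"
    unfolding cinner_self_norm[symmetric] by (simp add: cinner_simps)
  also have "\<dots> = complex_of_real ((cmod a * norm x)\<^sup>2)"
    by (simp only: complex_norm_square[symmetric] power_mult_distrib of_real_mult)
  finally show ?thesis
    by (subst (asm) of_real_eq_iff) (simp add: power2_eq_iff_nonneg)
qed

text \<open>In a normed space the triangle inequality is already available and yields Cauchy--Schwarz.\<close>

lemma Re_cinner_le: "Re (cinner x y) \<le> norm x * norm (y::'a::complex_inner)"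
proof -
  have "(norm (x + y))\<^sup>2 \<le> (norm x + norm y)\<^sup>2"
    by (intro power_mono norm_triangle_ineq norm_ge_zero)
  then show ?thesis
    unfolding norm_add_sq by (simp add: power2_sum)
qed

lemma cmod_cinner_le: "cmod (cinner x y) \<le> norm x * norm (y::'a::complex_inner)"
proof (cases "cinner x y = 0")
  case False
  \<comment> \<open>The phase \<open>u\<close> rotates \<open>cinner x y\<close> onto the positive
    real axis, so the bound on real parts bounds the modulus.\<close>
  define u where "u = cnj (cinner x y) / of_real (cmod (cinner x y))"
  have u: "cmod u = 1"
    using False by (simp add: u_def norm_divide)
  have "u * cinner x y = of_real (cmod (cinner x y))"
    using False complex_norm_square[of "cinner x y"]
    by (simp add: u_def field_simps power2_eq_square)
  then have "cmod (cinner x y) = Re (cinner (u *\<^sub>C x) y)"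
    by (simp add: cinner_simps)
  also have "\<dots> \<le> norm x * norm y"
    using Re_cinner_le[of "u *\<^sub>C x" y] by (simp add: norm_scaleC u)
  finally show ?thesis .
qed simp

lemma cinner_eq_right_imp_eq:
  assumes "\<And>x. cinner x y = cinner x (z::'a::complex_inner)"
  shows "y = z"
proof -
  have "Re (cinner (y - z) (y - z)) = 0"
    by (simp add: cinner_diff_right assms)
  then show ?thesis
    by (simp add: Re_cinner_self)
qed

section \<open>Riesz representation and existence of the adjoint\<close>

lemma linear_coeff_eq_0:
  fixes a b :: real
  assumes "\<And>t. 0 \<le> t\<^sup>2 * a + t * b"
  shows "b = 0"
proof (rule ccontr)
  assume b: "b \<noteq> 0"
  define c where "c = \<bar>a\<bar> + 1"
  have c: "c > 0" "a < c"
    by (auto simp: c_def)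
  have "(- b / c)\<^sup>2 * a + (- b / c) * b = b\<^sup>2 * (a - c) / c\<^sup>2"
    using c by (simp add: field_simps power2_eq_square)
  also have "\<dots> < 0"
    using b c by (intro divide_neg_pos mult_pos_neg) auto
  finally show False
    using assms[of "- b / c"] by simp
qed

text \<open>The representing vector minimises \<open>\<parallel>x\<parallel>\<^sup>2 - 2 Re (f x)\<close>.\<close>

lemma riesz_representation_Re:
  fixes f :: "'a::chilbert_space \<Rightarrow> real"
  assumes "bounded_linear f"
  obtains z where "\<And>x. f x = Re (cinner x z)"
proof -
  interpret f: bounded_linear f by fact
  define J where "J x = (norm x)\<^sup>2 - 2 * f x" for x
  obtain K where K: "\<And>x. \<bar>f x\<bar> \<le> norm x * K"
    using f.bounded by auto
  \<comment> \<open>Completing the square: \<open>J x\<close> is at least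
    \<open>(norm x - K)\<^sup>2 - K\<^sup>2\<close>.\<close>
  have J_ge: "- K\<^sup>2 \<le> J x" for x
  proof -
    have "0 \<le> (norm x - K)\<^sup>2" by simp
    then show ?thesis
      using K[of x] by (simp add: J_def power2_diff abs_le_iff mult.commute)
  qed
  define m where "m = Inf (range J)"
  have m_le: "m \<le> J x" for x
    unfolding m_def by (rule cInf_lower) (auto intro!: bdd_belowI[of _ "- K\<^sup>2"] J_ge)
  have "\<exists>x. J x < m + 1 / Suc n" for n
    using cInf_lessD[of "range J" "m + 1 / Suc n"] by (auto simp: m_def)
  then obtain X where X: "\<And>n. J (X n) < m + 1 / Suc n"
    by metis
  \<comment> \<open>Parallelogram law: the midpoint \<open>c\<close> has \<open>J c\<close> at least
    \<open>m\<close>, so two near-minimisers must be close. Hence minimising sequences are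
    Cauchy.\<close>
  have close: "(norm (x - y))\<^sup>2 \<le> 2 * (J x - m) + 2 * (J y - m)" for x y
  proof -
    define c where "c = (1 / 2) *\<^sub>R (x + y)"
    have "(norm c)\<^sup>2 = (norm (x + y))\<^sup>2 / 4" and "2 * f c = f x + f y"
      by (simp_all add: c_def power_mult_distrib power_divide f.scaleR f.add)
    moreover have "m \<le> J c"
      by (rule m_le)
    ultimately show ?thesis
      unfolding J_def norm_add_sq norm_diff_sq by argo
  qed
  have "Cauchy X"
  proof (rule metric_CauchyI)
    fix e :: real assume e: "e > 0"
    then obtain N where N: "1 / real (Suc N) < e\<^sup>2 / 4"
      using nat_approx_posE[of "e\<^sup>2 / 4"] by (metis divide_pos_pos zero_less_numeral zero_less_power)
    have J_N: "J (X n) - m < e\<^sup>2 / 4" if "n \<ge> N" for n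
    proof -
      have "1 / real (Suc n) \<le> 1 / real (Suc N)"
        using that by (simp add: frac_le)
      then show ?thesis
        using X[of n] N by linarith
    qed
    have "dist (X i) (X j) < e" if "i \<ge> N" "j \<ge> N" for i j
    proof -
      have "(norm (X i - X j))\<^sup>2 < e\<^sup>2"
        using close[of "X i" "X j"] J_N[OF that(1)] J_N[OF that(2)] by argo
      then show ?thesis
        using e by (simp add: dist_norm power2_less_imp_less)
    qed
    then show "\<exists>N. \<forall>i\<ge>N. \<forall>j\<ge>N. dist (X i) (X j) < e"
      by blast
  qed
  then obtain z where z: "X \<longlonglongrightarrow> z"
    using Cauchy_convergent_iff convergent_def by blast
  have "(\<lambda>n. J (X n)) \<longlonglongrightarrow> J z"
    unfolding J_def by (intro tendsto_intros z f.tendsto)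
  moreover have "(\<lambda>n. m + 1 / real (Suc n)) \<longlonglongrightarrow> m"
    using LIMSEQ_inverse_real_of_nat_add[of m] by (simp add: inverse_eq_divide)
  ultimately have Jz: "J z \<le> m"
    using X by (intro LIMSEQ_le) (auto intro: less_imp_le)
  have "f h = Re (cinner h z)" for h
  proof -
    \<comment> \<open>First variation at the minimiser: the right-hand side is
      \<open>J (z + t *\<^sub>R h) - J z\<close>.\<close>
    have "0 \<le> t\<^sup>2 * (norm h)\<^sup>2 + t * (2 * (Re (cinner h z) - f h))" for t
    proof -
      have "J z \<le> J (z + t *\<^sub>R h)"
        using Jz m_le order_trans by blast
      then show ?thesis
        unfolding J_def norm_add_sq f.add f.scaleR
        by (simp add: cinner_simps power_mult_distrib Re_cinner_commute[of z h] algebra_simps)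
    qed
    from linear_coeff_eq_0[OF this] show ?thesis by simp
  qed
  then show ?thesis by (rule that)
qed

lemma cadjoint_exists:
  fixes S :: "'a::chilbert_space \<Rightarrow> 'a"
  assumes "bounded_clinear S"
  shows "\<exists>T. \<forall>x y. cinner (S x) y = cinner x (T y)"
proof -
  interpret S: bounded_clinear S by fact
  have "\<exists>z. \<forall>x. cinner (S x) y = cinner x z" for y
  proof -
    have "bounded_linear (\<lambda>x. Re (cinner (S x) y))"
    proof (rule bounded_linear_intro)
      fix x
      have "\<bar>Re (cinner (S x) y)\<bar> \<le> norm (S x) * norm y"
        using abs_Re_le_cmod cmod_cinner_le order_trans by blast
      also have "\<dots> \<le> (onorm S * norm x) * norm y"
        by (intro mult_right_mono onorm S.bounded_linear_axioms) simp
      finally show "norm (Re (cinner (S x) y)) \<le> norm x * (onorm S * norm y)"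
        by (simp add: mult_ac)
    qed (simp_all add: S.add S.scaleR cinner_simps)
    then obtain z where z: "\<And>x. Re (cinner (S x) y) = Re (cinner x z)"
      using riesz_representation_Re by blast
    \<comment> \<open>The representation covers real parts only; since
      \<open>Re (- \<i> * c) = Im c\<close>, complex linearity of \<open>S\<close> recovers the
      imaginary part.\<close>
    have "Im (cinner (S x) y) = Im (cinner x z)" for x
      using z[of "(- \<i>) *\<^sub>C x"] by (simp add: S.scaleC cinner_scaleC_left)
    with z have "\<forall>x. cinner (S x) y = cinner x z"
      by (simp add: complex_eq_iff)
    then show ?thesis ..
  qed
  then show ?thesis by metis
qed

text \<open>Unfolds the definite description: existence comes from Riesz, uniqueness from
  nondegeneracy of the inner product.\<close>

lemma cinner_cadjoint_right:
  fixes S :: "'a::chilbert_space \<Rightarrow> 'a"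
  assumes "bounded_clinear S"
  shows "cinner x (cadjoint S y) = cinner (S x) y"
proof -
  obtain T where T: "\<forall>x y. cinner (S x) y = cinner x (T y)"
    using cadjoint_exists[OF assms] by blast
  have "cadjoint S = T"
    unfolding cadjoint_def
  proof (rule the_equality)
    fix T' assume T': "\<forall>x y. cinner (S x) y = cinner x (T' y)"
    show "T' = T"
    proof (rule ext, rule cinner_eq_right_imp_eq)
      fix y x
      show "cinner x (T' y) = cinner x (T y)"
        by (simp only: T[rule_format, symmetric] T'[rule_format, symmetric])
    qed
  qed (rule T)
  with T show ?thesis by simp
qed

lemma cinner_cadjoint_left:
  fixes S :: "'a::chilbert_space \<Rightarrow> 'a"
  assumes "bounded_clinear S"
  shows "cinner (cadjoint S x) y = cinner x (S y)"
proof -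
  have "cinner (cadjoint S x) y = cnj (cinner y (cadjoint S x))"
    by (rule cinner_commute)
  also have "\<dots> = cnj (cinner (S y) x)"
    by (simp only: cinner_cadjoint_right[OF assms])
  also have "\<dots> = cinner x (S y)"
    by (rule cinner_commute[symmetric])
  finally show ?thesis .
qed

section \<open>Norm bounds for symmetric operators\<close>

text \<open>Additivity is derived from this identity below, so for \<open>op_Re S\<close> and
  \<open>op_Im S\<close> only symmetry has to be checked.\<close>

definition symmetric_op :: "('a::complex_inner \<Rightarrow> 'a) \<Rightarrow> bool" where
  "symmetric_op T \<longleftrightarrow> (\<forall>x y. cinner (T x) y = cinner x (T y))"

lemma symmetric_opD: "symmetric_op T \<Longrightarrow> cinner (T x) y = cinner x (T y)"
  by (simp add: symmetric_op_def)

lemma symmetric_op_Im_cinner_self: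
  assumes "symmetric_op T"
  shows "Im (cinner x (T x)) = 0"
proof -
  have "Im (cinner x (T x)) = - Im (cinner (T x) x)"
    by (rule Im_cinner_commute)
  then show ?thesis
    unfolding symmetric_opD[OF assms] by linarith
qed

lemma symmetric_op_add:
  assumes "symmetric_op T"
  shows "T (x + y) = T x + T y"
  by (rule cinner_eq_right_imp_eq) (simp add: cinner_add_right flip: symmetric_opD[OF assms])

lemma symmetric_op_diff:
  assumes "symmetric_op T"
  shows "T (x - y) = T x - T y"
  by (rule cinner_eq_right_imp_eq) (simp add: cinner_diff_right flip: symmetric_opD[OF assms])

lemma symmetric_op_zero: "symmetric_op T \<Longrightarrow> T 0 = 0"
  using symmetric_op_diff[of T 0 0] by simp

text \<open>Polarization: for symmetric \<open>T\<close> the quadratic forms at \<open>x + y\<close>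
  and \<open>x - y\<close> differ by \<open>4 * Re (cinner (T x) y)\<close>, and the parallelogram
  law adds up their bounds.\<close>

lemma symmetric_op_Re_cinner_le:
  fixes T :: "'a::complex_inner \<Rightarrow> 'a"
  assumes T: "symmetric_op T" and c: "\<And>x. \<bar>Re (cinner (T x) x)\<bar> \<le> c * (norm x)\<^sup>2"
  shows "2 * Re (cinner (T x) y) \<le> c * ((norm x)\<^sup>2 + (norm y)\<^sup>2)"
proof -
  have "Re (cinner (T (x + y)) (x + y)) - Re (cinner (T (x - y)) (x - y))
      = 2 * Re (cinner (T x) y) + 2 * Re (cinner (T y) x)"
    by (simp add: symmetric_op_add[OF T] symmetric_op_diff[OF T] cinner_simps)
  also have "Re (cinner (T y) x) = Re (cinner (T x) y)"
    using Re_cinner_commute[of y "T x"] by (simp add: symmetric_opD[OF T, of y x])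
  finally have "4 * Re (cinner (T x) y) \<le> c * (norm (x + y))\<^sup>2 + c * (norm (x - y))\<^sup>2"
    using c[of "x + y"] c[of "x - y"] by linarith
  also have "\<dots> = 2 * (c * ((norm x)\<^sup>2 + (norm y)\<^sup>2))"
    by (simp add: norm_add_sq norm_diff_sq algebra_simps)
  finally show ?thesis by simp
qed

lemma symmetric_op_norm_le:
  fixes T :: "'a::complex_inner \<Rightarrow> 'a"
  assumes T: "symmetric_op T" and c: "\<And>x. \<bar>Re (cinner (T x) x)\<bar> \<le> c * (norm x)\<^sup>2"
  shows "norm (T x) \<le> c * norm x"
proof -
  show ?thesis
  proof (cases "x = 0 \<or> T x = 0")
    case True
    moreover have "0 \<le> c * norm x"
    proof (cases "x = 0")
      case False
      \<comment> \<open>At a nonzero vector the assumed bound itself forces \<open>c\<close> to be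
        nonnegative.\<close>
      have "0 \<le> c * (norm x)\<^sup>2"
        using c[of x] by linarith
      with False show ?thesis
        by (simp add: zero_le_mult_iff)
    qed simp
    ultimately show ?thesis
      using symmetric_op_zero[OF T] by auto
  next
    case False
    \<comment> \<open>The vector along \<open>T x\<close> with the length of \<open>x\<close> makes
      the inner product equal to the product of norms.\<close>
    define y where "y = (norm x / norm (T x)) *\<^sub>R T x"
    have "Re (cinner (T x) y) = norm x * norm (T x)"
      using False by (simp add: y_def cinner_scaleR_right Re_cinner_self power2_eq_square)
    moreover have "norm y = norm x"
      using False by (simp add: y_def)
    ultimately have "2 * (norm x * norm (T x)) \<le> 2 * (norm x * (c * norm x))"
      using symmetric_op_Re_cinner_le[OF T c, of x y] by (simp add: power2_eq_square algebra_simps)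
    then show ?thesis
      using False by simp
  qed
qed

text \<open>Bounds the cross term in both cases: \<open>P\<close> stands for the positive one of the
  two parts of \<open>S\<close>, \<open>Q\<close> for the other.\<close>

lemma symmetric_op_Im_cinner_le:
  fixes P Q :: "'a::complex_inner \<Rightarrow> 'a"
  assumes P: "symmetric_op P" and Q: "symmetric_op Q" and w: "w \<ge> 0"
    and P_nonneg: "\<And>x. 0 \<le> Re (cinner (P x) x)"
    and P_le: "\<And>x. Re (cinner (P x) x) \<le> w * (norm x)\<^sup>2"
    and Q_le: "\<And>x. \<bar>Re (cinner (Q x) x)\<bar> \<le> w * (norm x)\<^sup>2"
  shows "2 * \<bar>Im (cinner (P x) (Q x))\<bar> \<le> w\<^sup>2 * (norm x)\<^sup>2"
proof -
  \<comment> \<open>Subtracting \<open>w / 2\<close> centres the range \<open>[0, w]\<close> of the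
    quadratic form at zero, halving its bound.\<close>
  define D where "D x = P x - (w / 2) *\<^sub>R x" for x
  have "symmetric_op D"
    unfolding symmetric_op_def D_def by (simp add: cinner_simps symmetric_opD[OF P])
  moreover have "\<bar>Re (cinner (D x) x)\<bar> \<le> (w / 2) * (norm x)\<^sup>2" for x
    using P_nonneg[of x] P_le[of x]
    by (simp add: D_def cinner_simps Re_cinner_self) (simp add: abs_if)
  ultimately have D_norm: "norm (D x) \<le> (w / 2) * norm x"
    by (rule symmetric_op_norm_le)
  have Q_norm: "norm (Q x) \<le> w * norm x"
    using Q Q_le by (rule symmetric_op_norm_le)
  have "Im (cinner (P x) (Q x)) = Im (cinner (D x) (Q x))"
    by (simp add: D_def cinner_simps symmetric_op_Im_cinner_self[OF Q])
  also have "\<bar>\<dots>\<bar> \<le> norm (D x) * norm (Q x)"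
    using abs_Im_le_cmod cmod_cinner_le order_trans by blast
  also have "\<dots> \<le> (w / 2 * norm x) * (w * norm x)"
    using w by (intro mult_mono D_norm Q_norm) auto
  finally show ?thesis
    by (simp add: power2_eq_square algebra_simps)
qed

section \<open>Real and imaginary parts of an operator\<close>

lemma symmetric_op_op_Re:
  assumes "bounded_clinear S"
  shows "symmetric_op (op_Re S)"
  unfolding symmetric_op_def op_Re_def
  by (simp add: cinner_simps cinner_cadjoint_left[OF assms] cinner_cadjoint_right[OF assms] add.commute)

lemma symmetric_op_op_Im:
  assumes "bounded_clinear S"
  shows "symmetric_op (op_Im S)"
  unfolding symmetric_op_def op_Im_def
  by (simp add: cinner_simps cinner_cadjoint_left[OF assms] cinner_cadjoint_right[OF assms] field_simps)

lemma op_Re_plus_op_Im: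
  fixes S :: "'a::chilbert_space \<Rightarrow> 'a"
  shows "S x = op_Re S x + \<i> *\<^sub>C op_Im S x"
proof -
  have "op_Re S x + \<i> *\<^sub>C op_Im S x
      = complex_of_real (1 / 2) *\<^sub>C (S x + cadjoint S x)
        + complex_of_real (1 / 2) *\<^sub>C (S x - cadjoint S x)"
    by (simp add: op_Re_def op_Im_def scaleC_scaleC)
  also have "\<dots> = S x"
    unfolding scaleC_of_real by (simp add: scaleR_right_distrib scaleR_right_diff_distrib flip: scaleR_left_distrib)
  finally show ?thesis by simp
qed

lemma Re_cinner_op_Re:
  "bounded_clinear S \<Longrightarrow> Re (cinner (op_Re S x) x) = Re (cinner (S x) x)"
  using Re_cinner_commute[of x "S x"]
  by (simp add: op_Re_def cinner_simps cinner_cadjoint_left)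

lemma Re_cinner_op_Im:
  "bounded_clinear S \<Longrightarrow> Re (cinner (op_Im S x) x) = Im (cinner (S x) x)"
  using Im_cinner_commute[of x "S x"] Re_cinner_commute[of x "S x"]
  by (simp add: op_Im_def cinner_simps cinner_cadjoint_left)

text \<open>Conjugate linearity in the second argument turns \<open>\<i>\<close> into
  \<open>- \<i>\<close>, so the real part in \<open>norm_add_sq\<close> becomes an imaginary
  part.\<close>

lemma norm_sq_op_Re_op_Im:
  fixes S :: "'a::chilbert_space \<Rightarrow> 'a"
  shows "(norm (S x))\<^sup>2 = (norm (op_Re S x))\<^sup>2 + (norm (op_Im S x))\<^sup>2
    + 2 * Im (cinner (op_Re S x) (op_Im S x))"
proof -
  have "(norm (S x))\<^sup>2 = (norm (op_Re S x + \<i> *\<^sub>C op_Im S x))\<^sup>2"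
    by (simp flip: op_Re_plus_op_Im)
  then show ?thesis
    by (simp add: norm_add_sq norm_scaleC cinner_simps)
qed

section \<open>Basic bounds for the numerical radius\<close>

text \<open>A real \<open>Sup\<close> dominates its set only when that set is bounded above;
  Cauchy--Schwarz gives the bound \<open>onorm S\<close>.\<close>

lemma numerical_radius_bdd_above:
  fixes S :: "'a::chilbert_space \<Rightarrow> 'a"
  assumes "bounded_linear S"
  shows "bdd_above (insert 0 {cmod (cinner (S x) x) | x. norm x = 1})"
proof -
  have "cmod (cinner (S x) x) \<le> onorm S" if "norm x = 1" for x
    using cmod_cinner_le[of "S x" x] onorm[OF assms, of x] that by simp
  then show ?thesis
    by (auto intro!: bdd_aboveI[of _ "onorm S"])
qed

lemma numerical_radius_nonneg:
  "bounded_linear S \<Longrightarrow> 0 \<le> numerical_radius S"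
  unfolding numerical_radius_def by (rule cSup_upper[OF _ numerical_radius_bdd_above]) auto

lemma cmod_cinner_le_numerical_radius:
  assumes "bounded_linear S"
  shows "cmod (cinner (S x) x) \<le> numerical_radius S * (norm x)\<^sup>2"
proof (cases "x = 0")
  case True
  then show ?thesis
    using cmod_cinner_le[of "S x" x] by simp
next
  case False
  define u where "u = (1 / norm x) *\<^sub>R x"
  have x: "x = norm x *\<^sub>R u" and u: "norm u = 1"
    using False by (simp_all add: u_def)
  have "cmod (cinner (S u) u) \<le> numerical_radius S"
    unfolding numerical_radius_def using u
    by (intro cSup_upper numerical_radius_bdd_above assms) auto
  moreover have "cinner (S x) x = of_real ((norm x)\<^sup>2) * cinner (S u) u"
    by (subst (1 2) x)
      (simp add: linear_simps(5)[OF assms] cinner_simps power2_eq_square)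
  ultimately show ?thesis
    by (simp add: norm_mult norm_power mult.commute mult_right_mono)
qed

section \<open>The norm inequality\<close>

lemma norm_le_numerical_radius:
  fixes S :: "'a::chilbert_space \<Rightarrow> 'a"
  assumes S: "bounded_clinear S" and "accretive S \<or> dissipative S"
  shows "norm (S x) \<le> sqrt 3 * numerical_radius S * norm x"
proof -
  define w where "w = numerical_radius S"
  interpret bounded_clinear S by fact
  have w: "w \<ge> 0"
    unfolding w_def by (rule numerical_radius_nonneg) (rule bounded_linear_axioms)
  have S_le: "cmod (cinner (S x) x) \<le> w * (norm x)\<^sup>2" for x
    unfolding w_def by (rule cmod_cinner_le_numerical_radius) (rule bounded_linear_axioms)
  have A_le: "\<bar>Re (cinner (op_Re S x) x)\<bar> \<le> w * (norm x)\<^sup>2" for x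
    unfolding Re_cinner_op_Re[OF S] using abs_Re_le_cmod S_le order_trans by blast
  have B_le: "\<bar>Re (cinner (op_Im S x) x)\<bar> \<le> w * (norm x)\<^sup>2" for x
    unfolding Re_cinner_op_Im[OF S] using abs_Im_le_cmod S_le order_trans by blast
  note A = symmetric_op_op_Re[OF S] and B = symmetric_op_op_Im[OF S]
  have "2 * \<bar>Im (cinner (op_Re S x) (op_Im S x))\<bar> \<le> w\<^sup>2 * (norm x)\<^sup>2"
    using assms(2)
  proof
    assume "accretive S"
    then have "0 \<le> Re (cinner (op_Re S y) y)" for y
      by (auto simp: accretive_def positive_op_def complex_nonneg_Reals_iff)
    then show ?thesis
      using A_le by (intro symmetric_op_Im_cinner_le A B w B_le) (auto simp: abs_le_iff)
  next
    assume "dissipative S"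
    then have "0 \<le> Re (cinner (op_Im S y) y)" for y
      by (auto simp: dissipative_def positive_op_def complex_nonneg_Reals_iff)
    then have "2 * \<bar>Im (cinner (op_Im S x) (op_Re S x))\<bar> \<le> w\<^sup>2 * (norm x)\<^sup>2"
      using B_le by (intro symmetric_op_Im_cinner_le A B w A_le) (auto simp: abs_le_iff)
    \<comment> \<open>Exchanging the arguments only flips the sign of the imaginary part.\<close>
    then show ?thesis
      using Im_cinner_commute[of "op_Re S x" "op_Im S x"] by simp
  qed
  moreover have "(norm (op_Re S x))\<^sup>2 \<le> (w * norm x)\<^sup>2"
    using A A_le by (intro power_mono symmetric_op_norm_le) auto
  moreover have "(norm (op_Im S x))\<^sup>2 \<le> (w * norm x)\<^sup>2"
    using B B_le by (intro power_mono symmetric_op_norm_le) auto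
  \<comment> \<open>The two squared norms and the cross term each contribute at most
    \<open>(w * norm x)\<^sup>2\<close>, whence the factor 3.\<close>
  ultimately have "(norm (S x))\<^sup>2 \<le> (sqrt 3 * w * norm x)\<^sup>2"
    unfolding norm_sq_op_Re_op_Im[of S x] by (simp add: power_mult_distrib abs_le_iff)
  then show ?thesis
    unfolding w_def[symmetric] by (rule power2_le_imp_le) (simp add: w)
qed

theorem theorem2p5:
  fixes S :: "'a::chilbert_space \<Rightarrow> 'a"
  assumes "bounded_clinear S"
  shows "(accretive S \<longrightarrow> sqrt 3 / 3 * onorm S \<le> numerical_radius S) \<and>
         (dissipative S \<longrightarrow> sqrt 3 / 3 * onorm S \<le> numerical_radius S)"
proof -
  interpret bounded_clinear S by fact
  have "sqrt 3 / 3 * onorm S \<le> numerical_radius S" if "accretive S \<or> dissipative S"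
  proof -
    have "onorm S \<le> sqrt 3 * numerical_radius S"
      using norm_le_numerical_radius[OF assms that] numerical_radius_nonneg[OF bounded_linear_axioms]
      by (intro onorm_bound) auto
    then have "sqrt 3 / 3 * onorm S \<le> sqrt 3 / 3 * (sqrt 3 * numerical_radius S)"
      by (rule mult_left_mono) simp
    also have "\<dots> = numerical_radius S"
      by (simp add: mult.assoc[symmetric])
    finally show ?thesis .
  qed
  then show ?thesis by blast
qed

end
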